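(* Let $G$ be a second countable locally compact group, let $G\curvearrowright X$ be a measure-preserving action on a standard probability space $X$, and let $\ell\colon X\times G\to\mathbb{R}_{\geq 0}$ be a measurable function such that $$\ell(x,gh)\le \ell(x,g)+\ell(g^{-1}x,h)$$ for a.e. $(x,g,h)\in X\times G\times G$. If $$\operatorname*{ess\,sup}_{g\in G}\int_X \ell(x,g)\,dx<+\infty,$$ then there exists $h\in L^1(X)$ such that $$\ell(x,g)\le h(x)+h(g^{-1}x)$$ for almost every $(x,g)\in X\times G$.
   Context: The group $G$ is equipped with its Haar measure; "almost every" and "ess sup" refer to this measure on $G$, the given probability measure on $X$, and their products. $dx$ denotes integration with respect to the probability measure on $X$. *)

theory Defs
  imports "HOL-Probability.Probability"
begin

text \<open>
  Topological groups are written additively, following the type class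
  \<^class>\<open>topological_group_add\<close>, which does not assume commutativity:
  \<open>g + h\<close> stands for the product $gh$, \<open>- g\<close> for $g^{-1}$ and \<open>0\<close> for the identity.
\<close>

text \<open>
  Left Haar measure. It will only be used on second countable locally compact Hausdorff groups,
  where every Borel measure that is finite on compact sets is automatically Radon, so that no
  regularity needs to be required.
\<close>

definition haar_measure :: "'g::topological_group_add measure \<Rightarrow> bool" where
  "haar_measure \<mu> \<longleftrightarrow>
     sets \<mu> = sets borel \<and>
     (\<forall>K. compact K \<longrightarrow> emeasure \<mu> K < \<infinity>) \<and>
     (\<forall>g. distr \<mu> \<mu> (\<lambda>h. g + h) = \<mu>) \<and>
     emeasure \<mu> UNIV \<noteq> 0"

text \<open>A Polish space with its Borel sigma-algebra (not completed) and a probability measure.\<close>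

definition standard_prob_space :: "'x measure \<Rightarrow> bool" where
  "standard_prob_space M \<longleftrightarrow>
     prob_space M \<and>
     (\<exists>T. completely_metrizable_space T \<and> second_countable T \<and> topspace T = space M \<and>
          sets M = sigma_sets (space M) {U. openin T U})"

definition measure_preserving_action ::
    "'x measure \<Rightarrow> ('g::topological_group_add \<Rightarrow> 'x \<Rightarrow> 'x) \<Rightarrow> bool" where
  "measure_preserving_action M act \<longleftrightarrow>
     (\<lambda>(g, x). act g x) \<in> borel \<Otimes>\<^sub>M M \<rightarrow>\<^sub>M M \<and>
     (\<forall>x\<in>space M. act 0 x = x) \<and>
     (\<forall>g h. \<forall>x\<in>space M. act (g + h) x = act g (act h x)) \<and>
     (\<forall>g. distr M M (act g) = M)"

end

(*
  Averaging a symmetric l over translations is not possible when G is not amenable.  Instead, after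
  symmetrising and truncating l, consider the functions V >= 0 on X x G with
  l(x,c) <= V(x,g) + V(c^-1 x, c^-1 g) and bounded mean displacement, such as V = l.  They form a
  convex set that is invariant under right translation of the group variable.  If V nearly
  minimises the essential supremum over g of the L^2 norm of V(.,g), then uniform convexity of L^2,
  applied to the midpoint of V and its average over right translates, yields g such that V(.,gk) is
  L^2-close to V(.,g) for most k.  Transporting V(.,g) by g gives h with
  l(x,c) <= h(x) + h(c^-1 x) up to a small L^1 error and with an L^1 bound that does not depend on
  the truncation.  The sets of such h are convex and decrease as the truncation level grows and the
  error shrinks; near-minimisers of the integral of exp(-h) have an a.e. convergent subsequence,
  whose limit is integrable by Fatou.

  Haar measure is replaced by an equivalent probability measure P, which is only quasi-invariant;
  null sets are all that invariance is needed for.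
*)

theory Submission
  imports Defs
begin

section \<open>Exchanging almost-everywhere quantifiers\<close>

lemma AE_swap:
  assumes "sigma_finite_measure A" "sigma_finite_measure B"
    and "Measurable.pred (A \<Otimes>\<^sub>M B) (\<lambda>(x, y). Q x y)"
    and "AE x in A. AE y in B. Q x y"
  shows "AE y in B. AE x in A. Q x y"
proof -
  interpret pair_sigma_finite A B
    using assms(1,2) by (simp add: pair_sigma_finite_def)
  have "{z \<in> space (A \<Otimes>\<^sub>M B). Q (fst z) (snd z)} \<in> sets (A \<Otimes>\<^sub>M B)"
    using predE[OF assms(3)] by (simp add: case_prod_beta)
  from AE_commute[OF this] assms(4) show ?thesis by simp
qed

lemma AE_pair_measureI:
  assumes "sigma_finite_measure A" "sigma_finite_measure B"
    and "Measurable.pred (A \<Otimes>\<^sub>M B) (\<lambda>(x, y). Q x y)"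
    and "AE x in A. AE y in B. Q x y"
  shows "AE (x, y) in A \<Otimes>\<^sub>M B. Q x y"
proof -
  interpret pair_sigma_finite A B
    using assms(1,2) by (simp add: pair_sigma_finite_def)
  show ?thesis
    using predE[OF assms(3)] assms(4) by (intro AE_pair_measure) (simp_all add: case_prod_beta)
qed

text \<open>Treating \<open>(y, z)\<close> as one variable of \<open>B \<Otimes>\<^sub>M C\<close>
  reduces this to a two-factor swap. Its main use is to put the point of X innermost: with the group
  elements fixed, invariance of the measure on X lets the point be moved by the action.\<close>

lemma AE_rotate:
  assumes "sigma_finite_measure A" "sigma_finite_measure B" "sigma_finite_measure C"
    and Q: "Measurable.pred (A \<Otimes>\<^sub>M (B \<Otimes>\<^sub>M C)) (\<lambda>(x, y, z). Q x y z)"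
    and ae: "AE x in A. AE y in B. AE z in C. Q x y z"
  shows "AE y in B. AE z in C. AE x in A. Q x y z"
proof -
  interpret BC: pair_sigma_finite B C
    using assms by (simp add: pair_sigma_finite_def)
  have BC: "sigma_finite_measure (B \<Otimes>\<^sub>M C)" ..
  have "AE x in A. AE w in B \<Otimes>\<^sub>M C. case w of (y, z) \<Rightarrow> Q x y z"
    using ae AE_space
  proof eventually_elim
    case (elim x)
    have "Measurable.pred (B \<Otimes>\<^sub>M C) (\<lambda>(y, z). Q x y z)"
      using measurable_compose[OF measurable_Pair1'[OF elim(2)] Q] by simp
    from AE_pair_measureI[OF assms(2,3) this] elim(1) show ?case by simp
  qed
  then have "AE w in B \<Otimes>\<^sub>M C. AE x in A. case w of (y, z) \<Rightarrow> Q x y z"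
    using Q by (intro AE_swap[OF assms(1) BC]) (simp_all add: case_prod_unfold)
  from BC.AE_pair[OF this] show ?thesis by simp
qed

section \<open>Almost-everywhere limits from nested convex families\<close>

lemma (in prob_space) square_integral_le:
  fixes f :: "'a \<Rightarrow> real"
  assumes "integrable M f" "integrable M (\<lambda>x. (f x)\<^sup>2)"
  shows "(\<integral>x. f x \<partial>M)\<^sup>2 \<le> (\<integral>x. (f x)\<^sup>2 \<partial>M)"
  using variance_eq[OF assms] variance_positive[of f] by simp

text \<open>\<open>ennreal\<close> sends negative reals to 0, so this is convexity of the positive
  part.\<close>

lemma ennreal_excess_midpoint:
  fixes a b :: real
  shows "ennreal (t - (a + b) / 2) \<le> (ennreal (t - a) + ennreal (t - b)) / 2"
proof -
  have "ennreal (t - (a + b) / 2) \<le> ennreal ((max 0 (t - a) + max 0 (t - b)) / 2)"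
    by (intro ennreal_leI) (simp add: max_def field_simps)
  also have "\<dots> = (ennreal (max 0 (t - a)) + ennreal (max 0 (t - b))) / 2"
    by (simp add: divide_ennreal[symmetric])
  also have "\<dots> = (ennreal (t - a) + ennreal (t - b)) / 2"
    by (simp add: ennreal_max_0)
  finally show ?thesis .
qed

text \<open>Strict convexity of exp(-t) in quantitative form: the value at the midpoint is the
  geometric mean, so the convexity defect is a perfect square. Near-minimality of the integral of
  exp(-h) thereby becomes an L^2 estimate for exp(-h/2).\<close>

lemma exp_midpoint_identity:
  fixes a b :: real
  shows "(exp (- a / 2) - exp (- b / 2))\<^sup>2 = exp (- a) + exp (- b) - 2 * exp (- ((a + b) / 2))"
  by (simp add: power2_diff power2_eq_square exp_add[symmetric] field_simps)

text \<open>The n-th increment has L^2 norm at most 2 * 2^-n, hence also L^1 norm at most that. The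
  series of absolute increments therefore has finite integral, so it is finite almost everywhere and
  the sequence telescopes to a convergent one. The uniform bound supplies integrability.\<close>

lemma (in prob_space) AE_convergent_of_summable_increments:
  fixes u :: "nat \<Rightarrow> 'a \<Rightarrow> real"
  assumes [measurable]: "\<And>n. u n \<in> borel_measurable M"
    and bound: "\<And>n x. x \<in> space M \<Longrightarrow> \<bar>u n x\<bar> \<le> 1"
    and sq: "\<And>n. (\<integral>x. (u (Suc n) x - u n x)\<^sup>2 \<partial>M) \<le> 4 * (1/4) ^ n"
  shows "AE x in M. convergent (\<lambda>n. u n x)"
proof -
  define d where "d n x = \<bar>u (Suc n) x - u n x\<bar>" for n x
  have [measurable]: "\<And>n. d n \<in> borel_measurable M"
    unfolding d_def by measurable
  have dle: "d n x \<le> 2" if "x \<in> space M" for n x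
    using bound[OF that, of n] bound[OF that, of "Suc n"] by (simp add: d_def)
  have int: "integrable M (d n)" for n
    by (rule integrable_const_bound[where B=2]) (auto simp: dle d_def intro: order.trans[OF dle[unfolded d_def]])
  have int2: "integrable M (\<lambda>x. (d n x)\<^sup>2)" for n
  proof (rule integrable_const_bound[where B=4])
    show "AE x in M. norm ((d n x)\<^sup>2) \<le> 4"
    proof (rule AE_I2)
      fix x assume "x \<in> space M"
      from power_mono[OF dle[OF this, of n], of 2] show "norm ((d n x)\<^sup>2) \<le> 4"
        by (simp add: d_def)
    qed
  qed simp
  have l1: "(\<integral>x. d n x \<partial>M) \<le> 2 * (1/2) ^ n" for n
  proof -
    have "(\<integral>x. d n x \<partial>M)\<^sup>2 \<le> (\<integral>x. (d n x)\<^sup>2 \<partial>M)"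
      by (rule square_integral_le[OF int int2])
    also have "\<dots> \<le> 4 * (1/4) ^ n" using sq[of n] by (simp add: d_def)
    also have "\<dots> = (2 * (1/2) ^ n)\<^sup>2"
      by (simp add: power2_eq_square power_mult_distrib[symmetric])
    finally show ?thesis by (rule power2_le_imp_le) simp
  qed
  have "(\<integral>\<^sup>+x. (\<Sum>n. ennreal (d n x)) \<partial>M) = (\<Sum>n. \<integral>\<^sup>+x. ennreal (d n x) \<partial>M)"
    by (intro nn_integral_suminf) simp
  also have "\<dots> = (\<Sum>n. ennreal (\<integral>x. d n x \<partial>M))"
    by (intro suminf_cong nn_integral_eq_integral int) (simp add: d_def)
  also have "\<dots> \<le> (\<Sum>n. ennreal (2 * (1/2) ^ n))"
    by (intro suminf_le ennreal_leI l1) auto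
  also have "\<dots> < \<top>"
    by (subst suminf_ennreal2) (auto intro!: summable_mult summable_geometric)
  finally have "(\<integral>\<^sup>+x. (\<Sum>n. ennreal (d n x)) \<partial>M) \<noteq> \<infinity>" by simp
  then have "AE x in M. (\<Sum>n. ennreal (d n x)) \<noteq> \<infinity>"
    by (intro nn_integral_PInf_AE) simp_all
  then show ?thesis
  proof eventually_elim
    case (elim x)
    then have "summable (\<lambda>n. d n x)"
      by (intro summable_suminf_not_top) (auto simp: d_def)
    then have "summable (\<lambda>n. u (Suc n) x - u n x)"
      unfolding d_def by (rule summable_rabs_cancel)
    then have "convergent (\<lambda>n. \<Sum>i<n. u (Suc i) x - u i x)"
      by (simp add: summable_iff_convergent)
    then have "convergent (\<lambda>n. u n x - u 0 x)"
      by (simp only: sum_lessThan_telescope[of "\<lambda>i. u i x"])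
    from convergent_add[OF this convergent_const[of "u 0 x"]]
    show ?case by simp
  qed
qed

text \<open>A compactness principle for bounded subsets of L^1. Near-minimisers of the strictly
  convex functional \<open>\<Phi>\<close> make exp(-u/2) Cauchy in L^2, because midpoints stay in
  the family and cannot beat the infimum. The L^1 bound prevents u from escaping to infinity and
  makes the limit integrable.\<close>

lemma (in prob_space) midpoint_convex_AE_limit:
  fixes H :: "nat \<Rightarrow> ('a \<Rightarrow> real) set"
  assumes ne: "\<And>n. H n \<noteq> {}"
    and dec: "\<And>n. H (Suc n) \<subseteq> H n"
    and meas: "\<And>n f. f \<in> H n \<Longrightarrow> f \<in> borel_measurable M"
    and nonneg: "\<And>n f x. f \<in> H n \<Longrightarrow> x \<in> space M \<Longrightarrow> 0 \<le> f x"
    and mid: "\<And>n f g. f \<in> H n \<Longrightarrow> g \<in> H n \<Longrightarrow> (\<lambda>x. (f x + g x) / 2) \<in> H n"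
    and bound: "\<And>n f. f \<in> H n \<Longrightarrow> (\<integral>\<^sup>+x. ennreal (f x) \<partial>M) \<le> ennreal C"
  shows "\<exists>u h. (\<forall>n. u n \<in> H n) \<and> integrable M h \<and> (AE x in M. (\<lambda>n. u n x) \<longlonglongrightarrow> h x)"
proof -
  define \<Phi> where "\<Phi> f = (\<integral>x. exp (- f x) \<partial>M)" for f :: "'a \<Rightarrow> real"
  define I where "I n = Inf (\<Phi> ` H n)" for n
  have int: "integrable M (\<lambda>x. exp (- f x))" if "f \<in> H n" for f n
    using meas[OF that] nonneg[OF that] by (intro integrable_const_bound[where B=1]) auto
  have \<Phi>0: "0 \<le> \<Phi> f" for f
    unfolding \<Phi>_def by (rule integral_nonneg_AE) simp
  have bdd: "bdd_below (\<Phi> ` H n)" for n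
    using \<Phi>0 by (auto intro!: bdd_belowI2)
  have I_le: "I n \<le> \<Phi> f" if "f \<in> H n" for n f
    unfolding I_def using that bdd by (intro cInf_lower) auto
  have \<Phi>1: "\<Phi> f \<le> 1" if "f \<in> H n" for f n
    unfolding \<Phi>_def using nonneg[OF that] int[OF that] by (intro integral_le_const) auto
  have "I n \<le> I (Suc n)" for n
    unfolding I_def using ne dec bdd by (intro cInf_superset_mono) auto
  then have inc: "incseq I" by (rule incseq_SucI)
  have I1: "I n \<le> 1" for n
    using ne[of n] I_le \<Phi>1 order.trans by blast
  obtain L where L: "I \<longlonglongrightarrow> L" "\<And>n. I n \<le> L"
    using incseq_convergent[OF inc, of 1] I1 by blast
  have "\<exists>N. \<forall>m\<ge>N. L - I m < (1/4) ^ n" for n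
    using order_tendstoD(1)[OF L(1), of "L - (1/4) ^ n"]
    by (auto simp: eventually_sequentially algebra_simps)
  then obtain N where N: "\<And>n m. N n \<le> m \<Longrightarrow> L - I m < (1/4) ^ n" by metis
  \<comment> \<open>Adding up all earlier thresholds makes \<open>r\<close> monotone while keeping
    it above both \<open>n\<close> and \<open>N n\<close>; monotonicity puts consecutive choices
    into the common set \<open>H (r n)\<close>.\<close>
  define r where "r n = n + (\<Sum>k\<le>n. N k)" for n
  have r: "n \<le> r n" "N n \<le> r n" "r n \<le> r (Suc n)" for n
    by (auto simp: r_def intro!: trans_le_add2 member_le_sum)
  have antimono: "H n \<subseteq> H m" if "m \<le> n" for m n
    using that dec by (rule lift_Suc_antimono_le[rotated])
  have "\<exists>f\<in>H (r n). \<Phi> f < I (r n) + (1/4) ^ n" for n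
    using cInf_lessD[of "\<Phi> ` H (r n)" "I (r n) + (1/4) ^ n"] ne by (auto simp: I_def)
  then obtain u where u: "\<And>n. u n \<in> H (r n)" "\<And>n. \<Phi> (u n) < I (r n) + (1/4) ^ n"
    by metis
  have uH: "u n \<in> H n" for n using u(1) antimono[OF r(1)] by blast
  have um[measurable]: "u n \<in> borel_measurable M" for n using meas[OF uH] .
  define v where "v n x = exp (- u n x / 2)" for n x
  have [measurable]: "v n \<in> borel_measurable M" for n unfolding v_def by measurable
  have sq: "(\<integral>x. (v (Suc n) x - v n x)\<^sup>2 \<partial>M) \<le> 4 * (1/4) ^ n" for n
  proof -
    have in_r: "u (Suc n) \<in> H (r n)" using u(1)[of "Suc n"] antimono[OF r(3)] by blast
    have p: "0 \<le> (1/4::real) ^ n" by simp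
    note m = mid[OF in_r u(1)[of n]]
    have "(\<integral>x. (v (Suc n) x - v n x)\<^sup>2 \<partial>M)
        = \<Phi> (u (Suc n)) + \<Phi> (u n) - 2 * \<Phi> (\<lambda>x. (u (Suc n) x + u n x) / 2)"
      unfolding v_def exp_midpoint_identity \<Phi>_def
      using int[OF in_r] int[OF u(1)[of n]] int[OF m] by simp
    also have "\<dots> \<le> (I (r (Suc n)) + (1/4) ^ Suc n) + (I (r n) + (1/4) ^ n) - 2 * I (r n)"
      using u(2)[of n] u(2)[of "Suc n"] I_le[OF m] by linarith
    also have "\<dots> \<le> (L - I (r n)) + 2 * (1/4) ^ n"
      using L(2)[of "r (Suc n)"] p unfolding power_Suc by linarith
    also have "\<dots> \<le> 4 * (1/4) ^ n"
      using N[OF r(2)[of n]] p by linarith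
    finally show ?thesis .
  qed
  have conv: "AE x in M. convergent (\<lambda>n. v n x)"
    by (rule AE_convergent_of_summable_increments[OF _ _ sq])
       (auto simp: v_def intro!: nonneg[OF uH])
  \<comment> \<open>This inverts v = exp(-u/2). Since \<open>lim\<close> is total, \<open>h\<close>
    is measurable on the whole space; its values where convergence fails lie on a null set.\<close>
  define h where "h x = - 2 * ln (lim (\<lambda>n. v n x))" for x
  have [measurable]: "h \<in> borel_measurable M" unfolding h_def by measurable
  have fatou: "(\<integral>\<^sup>+x. liminf (\<lambda>n. ennreal (u n x)) \<partial>M) \<le> ennreal C"
  proof -
    have "(\<integral>\<^sup>+x. liminf (\<lambda>n. ennreal (u n x)) \<partial>M) \<le> liminf (\<lambda>n. \<integral>\<^sup>+x. ennreal (u n x) \<partial>M)"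
      by (intro nn_integral_liminf) simp
    also have "\<dots> \<le> liminf (\<lambda>n. ennreal C)"
      by (intro Liminf_mono always_eventually allI bound[OF uH])
    finally show ?thesis by (simp add: Liminf_const)
  qed
  have "AE x in M. liminf (\<lambda>n. ennreal (u n x)) \<noteq> \<infinity>"
    using fatou by (intro nn_integral_PInf_AE) (auto simp: top_unique)
  with conv AE_space have lim: "AE x in M. (\<lambda>n. u n x) \<longlonglongrightarrow> h x"
  proof eventually_elim
    case (elim x)
    define F where "F = lim (\<lambda>n. v n x)"
    have F: "(\<lambda>n. v n x) \<longlonglongrightarrow> F"
      using elim(1) by (simp add: F_def convergent_LIMSEQ_iff)
    have u_ln: "u n x = - 2 * ln (v n x)" for n by (simp add: v_def)
    \<comment> \<open>If the limit of exp(-u/2) were 0, u would tend to infinity, against the finite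
      liminf provided by Fatou.\<close>
    have "F \<noteq> 0"
    proof
      assume "F = 0"
      with F have "filterlim (\<lambda>n. v n x) (at_right 0) sequentially"
        by (intro tendsto_imp_filterlim_at_right) (auto simp: v_def)
      from filterlim_compose[OF ln_at_0 this]
      have "filterlim (\<lambda>n. u n x) at_top sequentially"
        by (auto simp: u_ln filterlim_uminus_at_top intro!: filterlim_tendsto_pos_mult_at_bot[of _ 2])
      then have "(\<lambda>n. ennreal (u n x)) \<longlonglongrightarrow> \<top>"
        by (simp add: ennreal_tendsto_top_eq_at_top)
      from lim_imp_Liminf[OF _ this] elim(3) show False by simp
    qed
    with F have "(\<lambda>n. - 2 * ln (v n x)) \<longlonglongrightarrow> - 2 * ln F"
      by (intro tendsto_intros) auto
    then show ?case by (simp add: u_ln h_def F_def)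
  qed
  have "integrable M h"
  proof (rule integrableI_bounded)
    have "AE x in M. ennreal (norm (h x)) = liminf (\<lambda>n. ennreal (u n x))"
      using lim AE_space
    proof eventually_elim
      case (elim x)
      have "0 \<le> h x"
        using elim nonneg[OF uH] by (intro LIMSEQ_le_const[OF elim(1)]) auto
      moreover have "liminf (\<lambda>n. ennreal (u n x)) = ennreal (h x)"
        using tendsto_ennrealI[OF elim(1)] by (intro lim_imp_Liminf) auto
      ultimately show ?case by simp
    qed
    from nn_integral_cong_AE[OF this] fatou
    show "(\<integral>\<^sup>+x. ennreal (norm (h x)) \<partial>M) < \<infinity>"
      by (simp add: le_less_trans)
  qed simp
  with uH lim show ?thesis by blast
qed

section \<open>Measure-preserving actions and quasi-invariant probability measures on the
  group\<close>

lemma borel_measurable_group_uminus [measurable (raw)]: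
  fixes f :: "'a \<Rightarrow> 'g::{topological_group_add, second_countable_topology}"
  assumes "f \<in> borel_measurable N"
  shows "(\<lambda>x. - f x) \<in> borel_measurable N"
  by (rule borel_measurable_continuous_on[OF _ assms]) (intro continuous_intros)

lemma borel_measurable_group_diff [measurable (raw)]:
  fixes f g :: "'a \<Rightarrow> 'g::{topological_group_add, second_countable_topology}"
  assumes [measurable]: "f \<in> borel_measurable N" "g \<in> borel_measurable N"
  shows "(\<lambda>x. f x - g x) \<in> borel_measurable N"
  unfolding diff_conv_add_uminus by measurable

text \<open>Total mass 1 makes averaging over the group possible. Invariance of \<open>P\<close> is
  asked for at the level of null sets only, whereas \<open>M\<close> is genuinely invariant.\<close>

locale quasi_invariant_action = M: prob_space M + P: prob_space P
  for M :: "'x measure"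
    and P :: "'g::{topological_group_add, second_countable_topology} measure"
    and act :: "'g \<Rightarrow> 'x \<Rightarrow> 'x" +
  assumes sets_P [measurable_cong]: "sets P = sets borel"
    and AE_translate: "\<And>Q k. AE g in P. Q g \<Longrightarrow> AE g in P. Q (k + g)"
    and AE_uminus: "\<And>Q. AE g in P. Q g \<Longrightarrow> AE g in P. Q (- g)"
    and act_measurable [measurable]: "(\<lambda>(g, x). act g x) \<in> borel \<Otimes>\<^sub>M M \<rightarrow>\<^sub>M M"
    and act_zero: "\<And>x. x \<in> space M \<Longrightarrow> act 0 x = x"
    and act_add: "\<And>g h x. x \<in> space M \<Longrightarrow> act (g + h) x = act g (act h x)"
    and distr_act: "\<And>g. distr M M (act g) = M"
begin

lemma space_P [simp]: "space P = UNIV"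
  using sets_eq_imp_space_eq[OF sets_P] by simp

lemma prob_P_UNIV [simp]: "measure P UNIV = 1"
  using P.prob_space by simp

lemma measurable_act [measurable]: "act g \<in> M \<rightarrow>\<^sub>M M"
  by measurable

lemma act_space: "x \<in> space M \<Longrightarrow> act g x \<in> space M"
  by (rule measurable_space[OF measurable_act])

lemma act_uminus_act: "x \<in> space M \<Longrightarrow> act (- g) (act g x) = x"
  by (simp flip: act_add add: act_zero)

lemma AE_act:
  assumes "AE x in M. Q x"
  shows "AE x in M. Q (act g x)"
proof (rule AE_distrD[OF measurable_act])
  show "AE x in distr M M (act g). Q x"
    using assms by (simp only: distr_act)
qed

lemma nn_integral_act:
  assumes "f \<in> borel_measurable M"
  shows "(\<integral>\<^sup>+x. f (act g x) \<partial>M) = (\<integral>\<^sup>+x. f x \<partial>M)"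
  using nn_integral_distr[OF measurable_act, of f g] assms by (simp add: distr_act)

text \<open>Right translation is left translation conjugated by inversion.\<close>

lemma AE_translate_right:
  assumes "AE g in P. Q g"
  shows "AE g in P. Q (g + k)"
proof -
  have "AE g in P. Q (- (- k + - g))"
    by (rule AE_uminus[OF AE_translate[OF AE_uminus[OF assms], of "- k"]])
  then show ?thesis by (simp add: minus_add)
qed

lemma AE_diff:
  assumes "AE g in P. Q g"
  shows "AE k in P. Q (g - k)"
  using AE_uminus[OF AE_translate[OF assms, of g]] by simp

lemmas sigma_finites = M.sigma_finite_measure_axioms P.sigma_finite_measure_axioms

end

section \<open>Symmetric lengths and admissible functions\<close>

locale symmetric_length = quasi_invariant_action +
  fixes l :: "'a \<Rightarrow> 'b \<Rightarrow> real" and c0 :: real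
  assumes l_measurable [measurable]: "(\<lambda>(x, g). l x g) \<in> borel_measurable (M \<Otimes>\<^sub>M P)"
    and l_nonneg: "\<And>x g. x \<in> space M \<Longrightarrow> 0 \<le> l x g"
    and l_sym: "\<And>x g. x \<in> space M \<Longrightarrow> l (act (- g) x) (- g) = l x g"
    and l_sub: "AE g in P. AE h in P. AE x in M. l x (g + h) \<le> l x g + l (act (- g) x) h"
    and l_int: "AE g in P. (\<integral>\<^sup>+x. ennreal (l x g) \<partial>M) \<le> ennreal c0"
    and c0_nonneg: "0 \<le> c0"
begin

text \<open>Read l(a^-1 x, a^-1 b) as a distance between a and b in the fibre over x. The last
  condition is then the triangle inequality from the identity to c through g, with \<open>V\<close>
  in place of the distance to g. It is linear in \<open>V\<close> and compatible with replacing g by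
  gk. The bound by \<open>N\<close> gives finite L^2 norms although l is only integrable.\<close>

definition admissible :: "real \<Rightarrow> ('a \<Rightarrow> 'b \<Rightarrow> real) \<Rightarrow> bool" where
  "admissible N V \<longleftrightarrow>
     (\<lambda>(x, g). V x g) \<in> borel_measurable (M \<Otimes>\<^sub>M P) \<and>
     (\<forall>x\<in>space M. \<forall>g. 0 \<le> V x g \<and> V x g \<le> N) \<and>
     (AE g in P. (\<integral>x. V x g \<partial>M) \<le> c0) \<and>
     (AE g in P. AE c in P. AE x in M. min N (l x c) \<le> V x g + V (act (- c) x) (- c + g))"

lemma admissible_truncation:
  assumes "0 \<le> N"
  shows "admissible N (\<lambda>x g. min N (l x g))"
  unfolding admissible_def
proof (intro conjI ballI allI)
  show "(\<lambda>(x, g). min N (l x g)) \<in> borel_measurable (M \<Otimes>\<^sub>M P)" by measurable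
next
  show "AE g in P. (\<integral>x. min N (l x g) \<partial>M) \<le> c0"
    using l_int
  proof eventually_elim
    case (elim g)
    have [measurable]: "(\<lambda>x. l x g) \<in> borel_measurable M" by measurable
    have "integrable M (\<lambda>x. min N (l x g))"
      using assms l_nonneg by (intro M.integrable_const_bound[where B=N]) auto
    then have "ennreal (\<integral>x. min N (l x g) \<partial>M) = (\<integral>\<^sup>+x. ennreal (min N (l x g)) \<partial>M)"
      using assms l_nonneg by (intro nn_integral_eq_integral[symmetric]) auto
    also have "\<dots> \<le> (\<integral>\<^sup>+x. ennreal (l x g) \<partial>M)"
      by (intro nn_integral_mono ennreal_leI) auto
    also note elim
    finally show ?case using c0_nonneg by simp
  qed
next
  show "AE g in P. AE c in P. AE x in M.
      min N (l x c) \<le> min N (l x g) + min N (l (act (- c) x) (- c + g))"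
    using l_sub
  proof eventually_elim
    case (elim g)
    \<comment> \<open>Subadditivity is applied to c = g(g^-1 c); symmetry then turns l(g^-1 x, g^-1
      c) into l(c^-1 x, c^-1 g). Truncation keeps the inequality because all terms are
      nonnegative.\<close>
    from AE_translate[OF elim, of "- g"] show ?case
    proof eventually_elim
      case (elim c)
      from elim AE_space show ?case
      proof eventually_elim
        case (elim x)
        have "l (act (- g) x) (- g + c) = l (act (- c) x) (- c + g)"
          using l_sym[of "act (- g) x" "- g + c"] elim(2) act_space
          by (simp add: minus_add flip: act_add)
        with elim assms show ?case
          using l_nonneg[of x g] l_nonneg[of "act (- c) x" "- c + g"] act_space[of x "- c"]
          by (auto simp: min_def)
      qed
    qed
  qed
qed (use assms l_nonneg in auto)

section \<open>Averaging over right translates and uniform convexity\<close>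

text \<open>Half of the weight stays on \<open>V\<close> itself, so that the gain in the L^2 norm
  measures how far \<open>V\<close> at g is from its translates.\<close>

definition average :: "('a \<Rightarrow> 'b \<Rightarrow> real) \<Rightarrow> 'a \<Rightarrow> 'b \<Rightarrow> real" where
  "average V x g = (V x g + (\<integral>k. V x (g - k) \<partial>P)) / 2"

lemma bounded_shift_integrable:
  fixes N :: real
  assumes [measurable]: "(\<lambda>(x, g). V x g) \<in> borel_measurable (M \<Otimes>\<^sub>M P)"
    and "\<And>x g. x \<in> space M \<Longrightarrow> 0 \<le> V x g \<and> V x g \<le> N" "x \<in> space M"
  shows "integrable P (\<lambda>k. V x (g - k))"
proof -
  have [measurable]: "V x \<in> borel_measurable P"
    using measurable_compose[OF measurable_Pair1'[OF assms(3)] assms(1)] by simp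
  show ?thesis
    using assms(2,3) by (intro P.integrable_const_bound[where B=N]) auto
qed

lemma admissible_average:
  assumes "admissible N V"
  shows "admissible N (average V)"
proof -
  have V[measurable]: "(\<lambda>(x, g). V x g) \<in> borel_measurable (M \<Otimes>\<^sub>M P)"
    and bd: "\<And>x g. x \<in> space M \<Longrightarrow> 0 \<le> V x g \<and> V x g \<le> N"
    and int: "AE g in P. (\<integral>x. V x g \<partial>M) \<le> c0"
    and ineq: "AE g in P. AE c in P. AE x in M. min N (l x c) \<le> V x g + V (act (- c) x) (- c + g)"
    using assms by (auto simp: admissible_def)
  have shift: "integrable P (\<lambda>k. V x (g - k))" if "x \<in> space M" for x g
    by (rule bounded_shift_integrable[OF V bd that])
  interpret MP: pair_prob_space M P ..
  have half: "m \<le> (v + a) / 2 + (w + b) / 2" if "m \<le> v + w" "m \<le> a + b" for m v w a b :: real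
    using that by (simp add: field_simps)
  show ?thesis
    unfolding admissible_def
  proof (intro conjI ballI allI)
    show "(\<lambda>(x, g). average V x g) \<in> borel_measurable (M \<Otimes>\<^sub>M P)"
      unfolding average_def by measurable
  next
    fix x g assume x: "x \<in> space M"
    show "0 \<le> average V x g"
      unfolding average_def using bd[OF x] by (intro divide_nonneg_pos add_nonneg_nonneg) auto
    have "(\<integral>k. V x (g - k) \<partial>P) \<le> N"
      using bd[OF x] shift[OF x] by (intro P.integral_le_const) auto
    then show "average V x g \<le> N"
      unfolding average_def using bd[OF x, of g] by simp
  next
    show "AE g in P. (\<integral>x. average V x g \<partial>M) \<le> c0"
      using int
    proof eventually_elim
      case (elim g)
      have [measurable]: "(\<lambda>x. V x g) \<in> borel_measurable M" by measurable
      have i1: "integrable M (\<lambda>x. V x g)"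
        using bd by (intro M.integrable_const_bound[where B=N]) auto
      have i2: "integrable (M \<Otimes>\<^sub>M P) (\<lambda>(x, k). V x (g - k))"
        using bd by (intro MP.integrable_const_bound[where B=N]) (auto simp: space_pair_measure)
      have "(\<integral>x. \<integral>k. V x (g - k) \<partial>P \<partial>M) = (\<integral>k. \<integral>x. V x (g - k) \<partial>M \<partial>P)"
        by (rule MP.Fubini_integral[OF i2, symmetric])
      also have "\<dots> \<le> c0"
        using AE_diff[OF int, of g] MP.integrable_snd[OF i2] by (intro P.integral_le_const) auto
      finally show ?case
        using elim i1 MP.integrable_fst[OF i2] by (simp add: average_def)
    qed
  next
    show "AE g in P. AE c in P. AE x in M.
        min N (l x c) \<le> average V x g + average V (act (- c) x) (- c + g)"
      using ineq
    proof eventually_elim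
      case (elim g)
      \<comment> \<open>The inequality at gk^-1 holds for almost every k. Bringing k innermost
        allows it to be integrated over k with c and x fixed.\<close>
      have "AE k in P. AE c in P. AE x in M.
          min N (l x c) \<le> V x (g - k) + V (act (- c) x) (- c + (g - k))"
        by (rule AE_diff[OF ineq])
      then have "AE c in P. AE x in M. AE k in P.
          min N (l x c) \<le> V x (g - k) + V (act (- c) x) (- c + (g - k))"
        by (intro AE_rotate[OF sigma_finites(2,2,1)]) measurable
      with elim show ?case
      proof eventually_elim
        case (elim c)
        from elim AE_space show ?case
        proof eventually_elim
          case (elim x)
          note cx = act_space[OF elim(3), of "- c"]
          have "min N (l x c) = (\<integral>k. min N (l x c) \<partial>P)"
            by simp
          also have "\<dots> \<le> (\<integral>k. V x (g - k) + V (act (- c) x) ((- c + g) - k) \<partial>P)"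
            using elim(2) shift[OF elim(3)] shift[OF cx]
            by (intro integral_mono_AE Bochner_Integration.integrable_add) (simp_all add: add_diff_eq)
          also have "\<dots> = (\<integral>k. V x (g - k) \<partial>P) + (\<integral>k. V (act (- c) x) ((- c + g) - k) \<partial>P)"
            using shift[OF elim(3)] shift[OF cx] by simp
          finally show ?case
            unfolding average_def by (rule half[OF elim(1)])
        qed
      qed
    qed
  qed
qed

text \<open>The average is the mean over k of the midpoints of V(x,g) and V(x,gk^-1). Jensen bounds
  its square by the mean of the squared midpoints, and the parallelogram identity (the function
  \<open>F\<close> below) produces the subtracted term.\<close>

lemma average_square_integral_le:
  assumes [measurable]: "(\<lambda>(x, g). V x g) \<in> borel_measurable (M \<Otimes>\<^sub>M P)"
    and bd: "\<And>x g. x \<in> space M \<Longrightarrow> 0 \<le> V x g \<and> V x g \<le> N"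
    and c: "(\<integral>x. (V x g)\<^sup>2 \<partial>M) \<le> c" "AE k in P. (\<integral>x. (V x (g - k))\<^sup>2 \<partial>M) \<le> c"
  shows "(\<integral>x. (average V x g)\<^sup>2 \<partial>M)
    \<le> c - (\<integral>k. \<integral>x. (V x (g - k) - V x g)\<^sup>2 \<partial>M \<partial>P) / 4"
proof -
  interpret MP: pair_prob_space M P ..
  have sq: "\<bar>t\<bar> \<le> B \<Longrightarrow> t\<^sup>2 \<le> B\<^sup>2" for t B :: real
    using power_mono[of "\<bar>t\<bar>" B 2] by simp
  have Vg[measurable]: "(\<lambda>x. V x g) \<in> borel_measurable M" by measurable
  define W where "W = (\<lambda>(x, k :: 'b). (V x g)\<^sup>2)"
  define U where "U = (\<lambda>(x, k). (V x (g - k))\<^sup>2)"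
  define D where "D = (\<lambda>(x, k). (V x (g - k) - V x g)\<^sup>2)"
  have [measurable]: "W \<in> borel_measurable (M \<Otimes>\<^sub>M P)" "U \<in> borel_measurable (M \<Otimes>\<^sub>M P)"
      "D \<in> borel_measurable (M \<Otimes>\<^sub>M P)"
    unfolding W_def U_def D_def by measurable
  have iW: "integrable (M \<Otimes>\<^sub>M P) W" and iU: "integrable (M \<Otimes>\<^sub>M P) U"
    and iD: "integrable (M \<Otimes>\<^sub>M P) D"
  proof -
    have "\<bar>V x g\<bar> \<le> N" "\<bar>V x (g - k)\<bar> \<le> N" "\<bar>V x (g - k) - V x g\<bar> \<le> N" if "x \<in> space M" for x k
      using bd[OF that, of g] bd[OF that, of "g - k"] by (simp_all add: abs_le_iff)
    from this[THEN sq]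
    show "integrable (M \<Otimes>\<^sub>M P) W" "integrable (M \<Otimes>\<^sub>M P) U" "integrable (M \<Otimes>\<^sub>M P) D"
      by (auto intro!: MP.integrable_const_bound[where B="N\<^sup>2"] AE_I2
          simp: W_def U_def D_def space_pair_measure)
  qed
  define F where "F = (\<lambda>z. W z / 2 + U z / 2 - D z / 4)"
  have iF: "integrable (M \<Otimes>\<^sub>M P) F"
    unfolding F_def using iW iU iD by simp
  have "(\<integral>x. (average V x g)\<^sup>2 \<partial>M) \<le> (\<integral>x. \<integral>k. F (x, k) \<partial>P \<partial>M)"
  proof (rule integral_mono)
    fix x assume x: "x \<in> space M"
    have s: "integrable P (\<lambda>k. V x (g - k))"
      by (rule bounded_shift_integrable[OF assms(1) bd x])
    define f where "f k = (V x g + V x (g - k)) / 2" for k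
    have f: "integrable P f"
      unfolding f_def using s by simp
    have f2: "integrable P (\<lambda>k. (f k)\<^sup>2)"
    proof (rule P.integrable_const_bound[where B="N\<^sup>2"])
      have "\<bar>f k\<bar> \<le> N" for k
        using bd[OF x, of g] bd[OF x, of "g - k"] by (simp add: f_def)
      from this[THEN sq] show "AE k in P. norm ((f k)\<^sup>2) \<le> N\<^sup>2" by simp
    qed (use f in measurable)
    have "average V x g = (\<integral>k. f k \<partial>P)"
      using s by (simp add: average_def f_def)
    then have "(average V x g)\<^sup>2 \<le> (\<integral>k. (f k)\<^sup>2 \<partial>P)"
      using P.square_integral_le[OF f f2] by simp
    also have "(\<lambda>k. (f k)\<^sup>2) = (\<lambda>k. F (x, k))"
      by (auto simp: f_def F_def W_def U_def D_def power2_eq_square field_simps)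
    finally show "(average V x g)\<^sup>2 \<le> (\<integral>k. F (x, k) \<partial>P)" .
  next
    have [measurable]: "(\<lambda>x. average V x g) \<in> borel_measurable M"
      unfolding average_def by measurable
    have "0 \<le> average V x g \<and> average V x g \<le> N" if x: "x \<in> space M" for x
    proof -
      have "integrable P (\<lambda>k. V x (g - k))"
        by (rule bounded_shift_integrable[OF assms(1) bd x])
      then have "(\<integral>k. V x (g - k) \<partial>P) \<le> N" "0 \<le> (\<integral>k. V x (g - k) \<partial>P)"
        using bd[OF x] by (auto intro!: P.integral_le_const)
      with bd[OF x, of g] show ?thesis by (simp add: average_def)
    qed
    then show "integrable M (\<lambda>x. (average V x g)\<^sup>2)"
      by (intro M.integrable_const_bound[where B="N\<^sup>2"]) (auto intro!: power_mono)
    show "integrable M (\<lambda>x. \<integral>k. F (x, k) \<partial>P)"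
      by (rule MP.integrable_fst'[OF iF])
  qed
  also have "\<dots> = integral\<^sup>L (M \<Otimes>\<^sub>M P) F"
    by (rule MP.integral_fst'[OF iF])
  also have "\<dots> = integral\<^sup>L (M \<Otimes>\<^sub>M P) W / 2 + integral\<^sup>L (M \<Otimes>\<^sub>M P) U / 2 - integral\<^sup>L (M \<Otimes>\<^sub>M P) D / 4"
    unfolding F_def using iW iU iD by simp
  also have "integral\<^sup>L (M \<Otimes>\<^sub>M P) W = (\<integral>x. (V x g)\<^sup>2 \<partial>M)"
    using MP.integral_fst'[OF iW] by (simp add: W_def)
  also have "integral\<^sup>L (M \<Otimes>\<^sub>M P) U = (\<integral>k. \<integral>x. (V x (g - k))\<^sup>2 \<partial>M \<partial>P)"
    using MP.integral_snd[OF iU[unfolded U_def]] by (simp add: U_def)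
  also have "integral\<^sup>L (M \<Otimes>\<^sub>M P) D = (\<integral>k. \<integral>x. (V x (g - k) - V x g)\<^sup>2 \<partial>M \<partial>P)"
    using MP.integral_snd[OF iD[unfolded D_def]] by (simp add: D_def)
  also have "(\<integral>k. \<integral>x. (V x (g - k))\<^sup>2 \<partial>M \<partial>P) \<le> c"
    using c(2) MP.integrable_snd[OF iU[unfolded U_def]] by (intro P.integral_le_const) auto
  finally show ?thesis using c(1) by simp
qed

text \<open>If almost every g had deviation above \<open>\<delta>\<close>, averaging would lower the
  essential bound of a near-minimiser by \<open>\<delta> / 4\<close>, below the infimum. The
  function \<open>V\<close> is chosen before \<open>Q\<close>, because the null sets to be avoided
  later depend on \<open>V\<close>.\<close>

lemma exists_almost_invariant:
  assumes N: "0 \<le> N" and \<delta>: "0 < \<delta>"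
  shows "\<exists>V. admissible N V \<and> (\<forall>Q. (AE g in P. Q g) \<longrightarrow>
    (\<exists>g. Q g \<and> (\<integral>k. \<integral>x. (V x (g - k) - V x g)\<^sup>2 \<partial>M \<partial>P) \<le> \<delta>))"
proof -
  define S where "S = {c. \<exists>V. admissible N V \<and> (AE g in P. (\<integral>x. (V x g)\<^sup>2 \<partial>M) \<le> c)}"
  have "N\<^sup>2 \<in> S"
  proof -
    have "(\<integral>x. (min N (l x g))\<^sup>2 \<partial>M) \<le> N\<^sup>2" for g
    proof -
      have [measurable]: "(\<lambda>x. l x g) \<in> borel_measurable M" by measurable
      have "(min N (l x g))\<^sup>2 \<le> N\<^sup>2" if "x \<in> space M" for x
        using N l_nonneg[OF that, of g] by (intro power_mono) auto
      then show ?thesis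
        by (intro M.integral_le_const M.integrable_const_bound[where B="N\<^sup>2"]) auto
    qed
    then show ?thesis
      using admissible_truncation[OF N] by (auto simp: S_def)
  qed
  moreover have S0: "0 \<le> c" if c: "c \<in> S" for c
  proof -
    from c obtain V where "AE g in P. (\<integral>x. (V x g)\<^sup>2 \<partial>M) \<le> c"
      by (auto simp: S_def)
    then have "AE g in P. 0 \<le> c"
      by eventually_elim (rule order.trans[OF Bochner_Integration.integral_nonneg, rotated], assumption, simp)
    then show ?thesis by simp
  qed
  \<comment> \<open>The slack \<open>\<delta> / 8\<close> is smaller than the gain
    \<open>\<delta> / 4\<close> from one averaging.\<close>
  ultimately obtain c where c: "c \<in> S" "c < Inf S + \<delta> / 8"
    using cInf_lessD[of S "Inf S + \<delta> / 8"] \<delta> by auto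
  then obtain V where V: "admissible N V" "AE g in P. (\<integral>x. (V x g)\<^sup>2 \<partial>M) \<le> c"
    by (auto simp: S_def)
  have meas: "(\<lambda>(x, g). V x g) \<in> borel_measurable (M \<Otimes>\<^sub>M P)"
    and bd: "\<And>x g. x \<in> space M \<Longrightarrow> 0 \<le> V x g \<and> V x g \<le> N"
    using V(1) by (auto simp: admissible_def)
  have "\<exists>g. Q g \<and> (\<integral>k. \<integral>x. (V x (g - k) - V x g)\<^sup>2 \<partial>M \<partial>P) \<le> \<delta>" if Q: "AE g in P. Q g" for Q
  proof (rule ccontr)
    assume no: "\<not> ?thesis"
    have "AE g in P. (\<integral>x. (average V x g)\<^sup>2 \<partial>M) \<le> c - \<delta> / 4"
      using V(2) Q
    proof eventually_elim
      case (elim g)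
      have "(\<integral>x. (average V x g)\<^sup>2 \<partial>M)
          \<le> c - (\<integral>k. \<integral>x. (V x (g - k) - V x g)\<^sup>2 \<partial>M \<partial>P) / 4"
        by (rule average_square_integral_le[OF meas bd elim(1) AE_diff[OF V(2)]])
      moreover have "\<delta> < (\<integral>k. \<integral>x. (V x (g - k) - V x g)\<^sup>2 \<partial>M \<partial>P)"
        using no elim(2) by (meson not_le)
      ultimately show ?case by linarith
    qed
    then have "c - \<delta> / 4 \<in> S"
      using admissible_average[OF V(1)] by (auto simp: S_def)
    then have "Inf S \<le> c - \<delta> / 4"
      using S0 by (intro cInf_lower bdd_belowI[of S 0])
    with c(2) \<delta> show False by linarith
  qed
  with V(1) show ?thesis by blast
qed

lemma exists_almost_invariant_L1:
  assumes N: "0 \<le> N" and \<epsilon>: "0 < \<epsilon>"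
  shows "\<exists>V. admissible N V \<and> (\<forall>Q. (AE g in P. Q g) \<longrightarrow>
    (\<exists>g. Q g \<and> (\<integral>\<^sup>+k. \<integral>\<^sup>+x. ennreal \<bar>V x (g - k) - V x g\<bar> \<partial>M \<partial>P) \<le> ennreal \<epsilon>))"
proof -
  \<comment> \<open>From |t| \<le> \<delta> + t^2/\<delta> and a mean square of at most \<delta>^2,
    the mean of |t| is at most 2\<delta>, which is \<epsilon>.\<close>
  define \<delta> where "\<delta> = \<epsilon> / 2"
  have \<delta>: "0 < \<delta>" using \<epsilon> by (simp add: \<delta>_def)
  then have "0 < \<delta>\<^sup>2" by simp
  from exists_almost_invariant[OF N this] obtain V where V: "admissible N V"
    and VQ: "\<And>Q. AE g in P. Q g \<Longrightarrow>
      \<exists>g. Q g \<and> (\<integral>k. \<integral>x. (V x (g - k) - V x g)\<^sup>2 \<partial>M \<partial>P) \<le> \<delta>\<^sup>2"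
    by blast
  have [measurable]: "(\<lambda>(x, g). V x g) \<in> borel_measurable (M \<Otimes>\<^sub>M P)"
    and bd: "\<And>x g. x \<in> space M \<Longrightarrow> 0 \<le> V x g \<and> V x g \<le> N"
    using V by (auto simp: admissible_def)
  interpret PM: pair_prob_space P M ..
  have "(\<integral>\<^sup>+k. \<integral>\<^sup>+x. ennreal \<bar>V x (g - k) - V x g\<bar> \<partial>M \<partial>P) \<le> ennreal \<epsilon>"
    if g: "(\<integral>k. \<integral>x. (V x (g - k) - V x g)\<^sup>2 \<partial>M \<partial>P) \<le> \<delta>\<^sup>2" for g
  proof -
    define D where "D = (\<lambda>(k, x). V x (g - k) - V x g)"
    have [measurable]: "D \<in> borel_measurable (P \<Otimes>\<^sub>M M)"
      unfolding D_def by measurable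
    have D_le: "\<bar>D (k, x)\<bar> \<le> N" if "x \<in> space M" for k x
      using bd[OF that, of g] bd[OF that, of "g - k"] by (simp add: D_def abs_le_iff)
    have iD: "integrable (P \<Otimes>\<^sub>M M) (\<lambda>z. (D z)\<^sup>2)"
    proof (rule PM.integrable_const_bound[where B="N\<^sup>2"])
      show "AE z in P \<Otimes>\<^sub>M M. norm ((D z)\<^sup>2) \<le> N\<^sup>2"
        using power_mono[OF D_le, where n=2] by (intro AE_I2) (auto simp: space_pair_measure)
    qed measurable
    have "\<bar>t\<bar> \<le> \<delta> + t\<^sup>2 / \<delta>" for t
    proof -
      have "0 \<le> (\<bar>t\<bar> - \<delta>)\<^sup>2 + \<bar>t\<bar> * \<delta>" using \<delta> by simp
      then have "\<bar>t\<bar> * \<delta> \<le> \<delta> * \<delta> + t\<^sup>2" by (simp add: power2_eq_square algebra_simps)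
      then show ?thesis using \<delta> by (simp add: field_simps)
    qed
    then have "(\<integral>\<^sup>+z. ennreal \<bar>D z\<bar> \<partial>(P \<Otimes>\<^sub>M M)) \<le> (\<integral>\<^sup>+z. ennreal (\<delta> + (D z)\<^sup>2 / \<delta>) \<partial>(P \<Otimes>\<^sub>M M))"
      by (intro nn_integral_mono ennreal_leI)
    also have "\<dots> = ennreal (\<integral>z. \<delta> + (D z)\<^sup>2 / \<delta> \<partial>(P \<Otimes>\<^sub>M M))"
      using iD \<delta> by (intro nn_integral_eq_integral) auto
    also have "(\<integral>z. \<delta> + (D z)\<^sup>2 / \<delta> \<partial>(P \<Otimes>\<^sub>M M)) = \<delta> + (\<integral>z. (D z)\<^sup>2 \<partial>(P \<Otimes>\<^sub>M M)) / \<delta>"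
      using iD PM.prob_space by simp
    also have "(\<integral>z. (D z)\<^sup>2 \<partial>(P \<Otimes>\<^sub>M M)) = (\<integral>k. \<integral>x. (V x (g - k) - V x g)\<^sup>2 \<partial>M \<partial>P)"
      using PM.integral_fst'[OF iD] by (simp add: D_def)
    also have "ennreal (\<delta> + (\<integral>k. \<integral>x. (V x (g - k) - V x g)\<^sup>2 \<partial>M \<partial>P) / \<delta>) \<le> ennreal \<epsilon>"
      using g \<delta> by (intro ennreal_leI) (simp add: field_simps power2_eq_square \<delta>_def)
    also have "(\<integral>\<^sup>+z. ennreal \<bar>D z\<bar> \<partial>(P \<Otimes>\<^sub>M M)) = (\<integral>\<^sup>+k. \<integral>\<^sup>+x. ennreal \<bar>D (k, x)\<bar> \<partial>M \<partial>P)"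
      by (rule M.nn_integral_fst[symmetric]) measurable
    finally show ?thesis by (simp add: D_def)
  qed
  with V VQ show ?thesis by meson
qed

section \<open>From almost invariance to approximate solutions\<close>

text \<open>As \<open>ennreal\<close> discards negative values, this integrates only the amount by
  which the desired inequality fails at truncation level \<open>N\<close>.\<close>

definition excess :: "real \<Rightarrow> ('a \<Rightarrow> real) \<Rightarrow> ennreal" where
  "excess N h = (\<integral>\<^sup>+c. \<integral>\<^sup>+x. ennreal (min N (l x c) - (h x + h (act (- c) x))) \<partial>M \<partial>P)"

text \<open>Two triangle inequalities bound l(x,c) by l(gx, gcg^-1) plus the lengths of g^-1 at x
  and at c^-1 x. The middle term is handled by \<open>V\<close> at the base point gx. Integrating,
  each of the two summands of \<open>h g\<close> contributes at most \<open>c0\<close>, whatever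
  \<open>N\<close> and \<open>\<epsilon>\<close> are.\<close>

lemma exists_small_excess:
  assumes N: "0 \<le> N" and \<epsilon>: "0 < \<epsilon>"
  shows "\<exists>h \<in> borel_measurable M. (\<forall>x\<in>space M. 0 \<le> h x) \<and>
    (\<integral>\<^sup>+x. ennreal (h x) \<partial>M) \<le> ennreal (2 * c0) \<and> excess N h \<le> ennreal \<epsilon>"
proof -
  from exists_almost_invariant_L1[OF N \<epsilon>] obtain V where V: "admissible N V"
    and VQ: "\<And>Q. AE g in P. Q g \<Longrightarrow>
      \<exists>g. Q g \<and> (\<integral>\<^sup>+k. \<integral>\<^sup>+x. ennreal \<bar>V x (g - k) - V x g\<bar> \<partial>M \<partial>P) \<le> ennreal \<epsilon>"
    by blast
  have [measurable]: "(\<lambda>(x, g). V x g) \<in> borel_measurable (M \<Otimes>\<^sub>M P)"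
    and bd: "\<And>x g. x \<in> space M \<Longrightarrow> 0 \<le> V x g \<and> V x g \<le> N"
    and int: "AE g in P. (\<integral>x. V x g \<partial>M) \<le> c0"
    and ineq: "AE g in P. AE c in P. AE x in M. min N (l x c) \<le> V x g + V (act (- c) x) (- c + g)"
    using V by (auto simp: admissible_def)
  \<comment> \<open>\<open>V\<close> is nearly constant under \<open>g \<mapsto> g - c\<close> only at one value of \<open>g\<close>, which depends on \<open>\<epsilon>\<close>.
    Moving the base point by \<open>act g\<close> turns the element \<open>- c + g\<close> of the inequality for \<open>V\<close> into \<open>g - c\<close>,
    so that the error is controlled by the fixed measure \<open>P\<close> and not by a conjugate of it.\<close>
  define h where "h g x = l x (- g) + V (act g x) g" for g x
  \<comment> \<open>\<open>sub1\<close> and \<open>sub2\<close> split off g^-1 at the two ends of c,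
    and \<open>sub3\<close> bounds the conjugate gcg^-1 that remains. The second term of
    \<open>sub3\<close> is V(gc^-1 x, gc^-1), whereas \<open>h g\<close> at c^-1 x contains V(gc^-1
    x, g); their difference is the error.\<close>
  have sub1: "AE g in P. AE c in P. AE x in M. l x c \<le> l x (- g) + l (act g x) (g + c)"
    using AE_uminus[OF l_sub]
  proof eventually_elim
    case (elim g)
    show ?case using AE_translate[OF elim, of g] by (simp flip: add.assoc)
  qed
  have "AE h in P. AE g in P. AE x in M. l x (g + h) \<le> l x g + l (act (- g) x) h"
  proof -
    have "AE h in P. AE x in M. AE g in P. l x (g + h) \<le> l x g + l (act (- g) x) h"
      by (rule AE_rotate[OF sigma_finites(2,2,1) _ l_sub]) measurable
    then show ?thesis
    proof eventually_elim
      case (elim h)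
      then show ?case by (intro AE_swap[OF sigma_finites]) measurable
    qed
  qed
  then have sub2: "AE g in P. AE c in P. AE x in M. l (act g x) (g + c)
      \<le> l (act g x) (g + c - g) + l (act (- c) x) (- g)"
  proof eventually_elim
    case (elim g)
    have "AE d in P. AE x in M. l (act g x) (d + g) \<le> l (act g x) d + l (act (- d) (act g x)) g"
      using elim by eventually_elim (rule AE_act)
    \<comment> \<open>The substitution d = gcg^-1 preserves null sets, being a right translation by
      g^-1 followed by a left translation by g.\<close>
    from AE_translate[OF AE_translate_right[OF this, of "- g"], of g] show ?case
    proof eventually_elim
      case (elim c)
      from elim AE_space show ?case
      proof eventually_elim
        case (elim x)
        have "l (act (- (g + c - g)) (act g x)) g = l (act (- c) x) (- g)"
          using l_sym[of "act (- (g + c - g)) (act g x)" g] elim(2) act_space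
          by (simp add: minus_add diff_conv_add_uminus add.assoc del: add_uminus_conv_diff flip: act_add)
        with elim(1) show ?case by (simp add: diff_conv_add_uminus add.assoc del: add_uminus_conv_diff)
      qed
    qed
  qed
  have sub3: "AE g in P. AE c in P. AE x in M. min N (l (act g x) (g + c - g))
      \<le> V (act g x) g + V (act g (act (- c) x)) (g - c)"
    using ineq
  proof eventually_elim
    case (elim g)
    then have "AE d in P. AE x in M. min N (l (act g x) d)
        \<le> V (act g x) g + V (act (- d) (act g x)) (- d + g)"
      by eventually_elim (rule AE_act)
    from AE_translate[OF AE_translate_right[OF this, of "- g"], of g] show ?case
    proof eventually_elim
      case (elim c)
      from elim AE_space show ?case
      proof eventually_elim
        case (elim x)
        then show ?case using act_space
          by (simp add: minus_add diff_conv_add_uminus add.assoc del: add_uminus_conv_diff flip: act_add)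
      qed
    qed
  qed
  have "AE g in P. (AE c in P. AE x in M. min N (l x c) \<le> h g x + h g (act (- c) x)
        + \<bar>V (act g (act (- c) x)) (g - c) - V (act g (act (- c) x)) g\<bar>)
      \<and> (\<integral>\<^sup>+x. ennreal (l x (- g)) \<partial>M) \<le> ennreal c0 \<and> (\<integral>x. V x g \<partial>M) \<le> c0"
    using sub1 sub2 sub3 AE_uminus[OF l_int] int
  proof eventually_elim
    case (elim g)
    from elim(1-3) have "AE c in P. AE x in M. min N (l x c) \<le> h g x + h g (act (- c) x)
        + \<bar>V (act g (act (- c) x)) (g - c) - V (act g (act (- c) x)) g\<bar>"
    proof eventually_elim
      case (elim c)
      from elim AE_space show ?case
      proof eventually_elim
        case (elim x)
        \<comment> \<open>As the two outer lengths are nonnegative, the truncation can be moved onto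
          the middle term, where \<open>sub3\<close> applies.\<close>
        have "0 \<le> l x (- g)" "0 \<le> l (act (- c) x) (- g)"
          using l_nonneg elim(4) act_space by blast+
        with elim(1-3) show ?case
          unfolding h_def by (simp add: min_def abs_if split: if_splits)
      qed
    qed
    with elim show ?case by blast
  qed
  \<comment> \<open>A single g now satisfies the pointwise inequality, both integral bounds and the
    small deviation.\<close>
  from VQ[OF this] obtain g
    where g: "AE c in P. AE x in M. min N (l x c) \<le> h g x + h g (act (- c) x)
        + \<bar>V (act g (act (- c) x)) (g - c) - V (act g (act (- c) x)) g\<bar>"
      and gl: "(\<integral>\<^sup>+x. ennreal (l x (- g)) \<partial>M) \<le> ennreal c0" and gV: "(\<integral>x. V x g \<partial>M) \<le> c0"
      and gD: "(\<integral>\<^sup>+k. \<integral>\<^sup>+x. ennreal \<bar>V x (g - k) - V x g\<bar> \<partial>M \<partial>P) \<le> ennreal \<epsilon>"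
    by blast
  have hm[measurable]: "h g \<in> borel_measurable M"
    unfolding h_def by measurable
  have [measurable]: "(\<lambda>x. V x g) \<in> borel_measurable M" "(\<lambda>x. l x (- g)) \<in> borel_measurable M"
    by measurable
  have h0: "\<forall>x\<in>space M. 0 \<le> h g x"
    using l_nonneg bd act_space by (simp add: h_def)
  have "(\<integral>\<^sup>+x. ennreal (V (act g x) g) \<partial>M) = (\<integral>\<^sup>+x. ennreal (V x g) \<partial>M)"
    by (rule nn_integral_act) measurable
  also have "\<dots> = ennreal (\<integral>x. V x g \<partial>M)"
    using bd by (intro nn_integral_eq_integral M.integrable_const_bound[where B=N]) auto
  also have "\<dots> \<le> ennreal c0"
    using gV by (rule ennreal_leI)
  finally have Vc: "(\<integral>\<^sup>+x. ennreal (V (act g x) g) \<partial>M) \<le> ennreal c0" .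
  have "(\<integral>\<^sup>+x. ennreal (h g x) \<partial>M) = (\<integral>\<^sup>+x. ennreal (l x (- g)) + ennreal (V (act g x) g) \<partial>M)"
    using l_nonneg bd act_space by (intro nn_integral_cong) (simp add: h_def)
  also have "\<dots> = (\<integral>\<^sup>+x. ennreal (l x (- g)) \<partial>M) + (\<integral>\<^sup>+x. ennreal (V (act g x) g) \<partial>M)"
    by (intro nn_integral_add) measurable
  also have "\<dots> \<le> ennreal c0 + ennreal c0"
    using gl Vc by (rule add_mono)
  also have "\<dots> = ennreal (2 * c0)"
    using c0_nonneg by (simp flip: ennreal_plus)
  finally have hc: "(\<integral>\<^sup>+x. ennreal (h g x) \<partial>M) \<le> ennreal (2 * c0)" .
  have "excess N (h g) \<le> (\<integral>\<^sup>+c. \<integral>\<^sup>+x. ennreal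
      \<bar>V (act g (act (- c) x)) (g - c) - V (act g (act (- c) x)) g\<bar> \<partial>M \<partial>P)"
    unfolding excess_def
  proof (intro nn_integral_mono_AE)
    show "AE c in P. (\<integral>\<^sup>+x. ennreal (min N (l x c) - (h g x + h g (act (- c) x))) \<partial>M)
      \<le> (\<integral>\<^sup>+x. ennreal \<bar>V (act g (act (- c) x)) (g - c) - V (act g (act (- c) x)) g\<bar> \<partial>M)"
      using g
    proof eventually_elim
      case (elim c)
      show ?case
      proof (intro nn_integral_mono_AE)
        show "AE x in M. ennreal (min N (l x c) - (h g x + h g (act (- c) x)))
            \<le> ennreal \<bar>V (act g (act (- c) x)) (g - c) - V (act g (act (- c) x)) g\<bar>"
          using elim by eventually_elim (rule ennreal_leI, linarith)
      qed
    qed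
  qed
  \<comment> \<open>For each fixed c, invariance of \<open>M\<close> is used twice, removing first
    the action of c^-1 and then that of g.\<close>
  also have "\<dots> = (\<integral>\<^sup>+c. \<integral>\<^sup>+x. ennreal \<bar>V x (g - c) - V x g\<bar> \<partial>M \<partial>P)"
  proof (rule nn_integral_cong)
    fix c
    have [measurable]: "(\<lambda>x. V x (g - c)) \<in> borel_measurable M" by measurable
    have "(\<integral>\<^sup>+x. ennreal \<bar>V (act g (act (- c) x)) (g - c) - V (act g (act (- c) x)) g\<bar> \<partial>M)
        = (\<integral>\<^sup>+x. ennreal \<bar>V (act g x) (g - c) - V (act g x) g\<bar> \<partial>M)"
      by (rule nn_integral_act) measurable
    also have "\<dots> = (\<integral>\<^sup>+x. ennreal \<bar>V x (g - c) - V x g\<bar> \<partial>M)"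
      by (rule nn_integral_act) measurable
    finally show "(\<integral>\<^sup>+x. ennreal \<bar>V (act g (act (- c) x)) (g - c) - V (act g (act (- c) x)) g\<bar> \<partial>M)
        = (\<integral>\<^sup>+x. ennreal \<bar>V x (g - c) - V x g\<bar> \<partial>M)" .
  qed
  also note gD
  finally show ?thesis using hm h0 hc by blast
qed

lemma excess_midpoint:
  assumes [measurable]: "f \<in> borel_measurable M" "g \<in> borel_measurable M"
  shows "excess N (\<lambda>x. (f x + g x) / 2) \<le> (excess N f + excess N g) / 2"
proof -
  have "excess N (\<lambda>x. (f x + g x) / 2)
      \<le> (\<integral>\<^sup>+c. \<integral>\<^sup>+x. (ennreal (min N (l x c) - (f x + f (act (- c) x)))
          + ennreal (min N (l x c) - (g x + g (act (- c) x)))) / 2 \<partial>M \<partial>P)"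
    unfolding excess_def
  proof (intro nn_integral_mono)
    fix c x
    show "ennreal (min N (l x c) - ((f x + g x) / 2 + (f (act (- c) x) + g (act (- c) x)) / 2))
        \<le> (ennreal (min N (l x c) - (f x + f (act (- c) x)))
          + ennreal (min N (l x c) - (g x + g (act (- c) x)))) / 2"
      using ennreal_excess_midpoint[of "min N (l x c)" "f x + f (act (- c) x)" "g x + g (act (- c) x)"]
      by (simp add: add_divide_distrib algebra_simps)
  qed
  also have "\<dots> = (\<integral>\<^sup>+c. ((\<integral>\<^sup>+x. ennreal (min N (l x c) - (f x + f (act (- c) x))) \<partial>M)
      + (\<integral>\<^sup>+x. ennreal (min N (l x c) - (g x + g (act (- c) x))) \<partial>M)) / 2 \<partial>P)"
  proof (rule nn_integral_cong)
    fix c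
    have [measurable]: "(\<lambda>x. l x c) \<in> borel_measurable M" by measurable
    show "(\<integral>\<^sup>+x. (ennreal (min N (l x c) - (f x + f (act (- c) x)))
          + ennreal (min N (l x c) - (g x + g (act (- c) x)))) / 2 \<partial>M)
        = ((\<integral>\<^sup>+x. ennreal (min N (l x c) - (f x + f (act (- c) x))) \<partial>M)
      + (\<integral>\<^sup>+x. ennreal (min N (l x c) - (g x + g (act (- c) x))) \<partial>M)) / 2"
      by (simp add: nn_integral_divide nn_integral_add)
  qed
  also have "\<dots> = (excess N f + excess N g) / 2"
    unfolding excess_def by (subst nn_integral_divide, measurable, subst nn_integral_add) simp_all
  finally show ?thesis .
qed

lemma excess_mono: "N \<le> N' \<Longrightarrow> excess N h \<le> excess N' h"
  unfolding excess_def by (intro nn_integral_mono ennreal_leI) auto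

text \<open>Fatou on the product shows that the liminf of the integrands vanishes almost everywhere.
  Pointwise the truncation is eventually inactive and u converges at x and, by invariance, at c^-1
  x, so this liminf is the positive part of l(x,c) - h(x) - h(c^-1 x).\<close>

lemma AE_le_of_excess_tendsto_0:
  assumes u: "\<And>n. u n \<in> borel_measurable M"
    and lim: "AE x in M. (\<lambda>n. u n x) \<longlonglongrightarrow> h x"
    and ex: "(\<lambda>n. excess (real n) (u n)) \<longlonglongrightarrow> 0"
  shows "AE c in P. AE x in M. l x c \<le> h x + h (act (- c) x)"
proof -
  note [measurable] = u
  define e where "e n c x = ennreal (min (real n) (l x c) - (u n x + u n (act (- c) x)))" for n c x
  have em[measurable]: "(\<lambda>(c, x). e n c x) \<in> borel_measurable (P \<Otimes>\<^sub>M M)" for n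
    unfolding e_def by measurable
  have "(\<integral>\<^sup>+c. \<integral>\<^sup>+x. liminf (\<lambda>n. e n c x) \<partial>M \<partial>P)
      = (\<integral>\<^sup>+z. liminf (\<lambda>n. case z of (c, x) \<Rightarrow> e n c x) \<partial>(P \<Otimes>\<^sub>M M))"
    by (subst M.nn_integral_fst[symmetric]) simp_all
  also have "\<dots> \<le> liminf (\<lambda>n. \<integral>\<^sup>+z. (case z of (c, x) \<Rightarrow> e n c x) \<partial>(P \<Otimes>\<^sub>M M))"
    by (intro nn_integral_liminf) measurable
  also have "\<dots> = liminf (\<lambda>n. excess (real n) (u n))"
    unfolding excess_def e_def[symmetric] by (subst M.nn_integral_fst[symmetric]) simp_all
  also have "\<dots> = 0"
    using ex by (intro lim_imp_Liminf) auto
  finally have "(\<integral>\<^sup>+c. \<integral>\<^sup>+x. liminf (\<lambda>n. e n c x) \<partial>M \<partial>P) = 0"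
    by simp
  then have "AE c in P. (\<integral>\<^sup>+x. liminf (\<lambda>n. e n c x) \<partial>M) = 0"
    by (subst (asm) nn_integral_0_iff_AE) simp_all
  then show ?thesis
  proof eventually_elim
    case (elim c)
    have "AE x in M. liminf (\<lambda>n. e n c x) = 0"
      using elim by (subst (asm) nn_integral_0_iff_AE) simp_all
    from this lim AE_act[OF lim, of "- c"] show ?case
    proof eventually_elim
      case (elim x)
      obtain m :: nat where "l x c \<le> real m" using real_arch_simple by blast
      then have "\<forall>\<^sub>F n in sequentially. l x c = min (real n) (l x c)"
        unfolding eventually_sequentially by (intro exI[of _ m]) auto
      then have "(\<lambda>n. min (real n) (l x c)) \<longlonglongrightarrow> l x c"
        by (rule Lim_transform_eventually[OF tendsto_const])
      then have "(\<lambda>n. e n c x) \<longlonglongrightarrow> ennreal (l x c - (h x + h (act (- c) x)))"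
        unfolding e_def using elim(2,3) by (intro tendsto_intros)
      from lim_imp_Liminf[OF _ this] elim(1) show ?case
        by (simp add: ennreal_eq_0_iff)
    qed
  qed
qed

theorem symmetric_length_bound:
  "\<exists>h. integrable M h \<and> (AE c in P. AE x in M. l x c \<le> h x + h (act (- c) x))"
proof -
  \<comment> \<open>Level n couples truncation at n with error 2^-n. The sets decrease because the
    excess grows with the truncation level, and the bound \<open>2 * c0\<close> is common to all of
    them.\<close>
  define H where "H n = {h \<in> borel_measurable M. (\<forall>x\<in>space M. 0 \<le> h x) \<and>
    (\<integral>\<^sup>+x. ennreal (h x) \<partial>M) \<le> ennreal (2 * c0) \<and> excess (real n) h \<le> ennreal ((1/2) ^ n)}" for n
  have mid_ennreal: "(a + b) / 2 \<le> c" if "a \<le> c" "b \<le> c" for a b c :: ennreal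
  proof -
    have "(a + b) / 2 \<le> (c + c) / 2"
      using that by (intro divide_right_mono_ennreal add_mono)
    also have "(c + c) / 2 = c"
      by (simp add: mult_divide_eq_ennreal flip: mult_2_right)
    finally show ?thesis .
  qed
  have "\<exists>u h. (\<forall>n. u n \<in> H n) \<and> integrable M h \<and> (AE x in M. (\<lambda>n. u n x) \<longlonglongrightarrow> h x)"
  proof (rule M.midpoint_convex_AE_limit[where C="2 * c0"])
    show "H n \<noteq> {}" for n
      using exists_small_excess[of "real n" "(1/2) ^ n"] by (auto simp: H_def)
    show "H (Suc n) \<subseteq> H n" for n
    proof
      fix h assume "h \<in> H (Suc n)"
      moreover have "excess (real n) h \<le> excess (real (Suc n)) h"
        by (rule excess_mono) simp
      moreover have "ennreal ((1/2) ^ Suc n) \<le> ennreal ((1/2) ^ n)"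
        by (rule ennreal_leI) simp
      ultimately show "h \<in> H n"
        unfolding H_def by (blast intro: order.trans)
    qed
    show "(\<lambda>x. (f x + g x) / 2) \<in> H n" if "f \<in> H n" "g \<in> H n" for n f g
    proof -
      have [measurable]: "f \<in> borel_measurable M" "g \<in> borel_measurable M"
        and nn: "\<And>x. x \<in> space M \<Longrightarrow> 0 \<le> f x" "\<And>x. x \<in> space M \<Longrightarrow> 0 \<le> g x"
        using that by (auto simp: H_def)
      have "(\<integral>\<^sup>+x. ennreal ((f x + g x) / 2) \<partial>M) = (\<integral>\<^sup>+x. (ennreal (f x) + ennreal (g x)) / 2 \<partial>M)"
        using nn by (intro nn_integral_cong) (simp add: divide_ennreal[symmetric])
      also have "\<dots> = ((\<integral>\<^sup>+x. ennreal (f x) \<partial>M) + (\<integral>\<^sup>+x. ennreal (g x) \<partial>M)) / 2"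
        by (simp add: nn_integral_divide nn_integral_add)
      also have "\<dots> \<le> ennreal (2 * c0)"
        using that by (intro mid_ennreal) (auto simp: H_def)
      finally have "(\<integral>\<^sup>+x. ennreal ((f x + g x) / 2) \<partial>M) \<le> ennreal (2 * c0)" .
      moreover have "excess (real n) (\<lambda>x. (f x + g x) / 2) \<le> ennreal ((1/2) ^ n)"
        using that by (intro order.trans[OF excess_midpoint] mid_ennreal) (auto simp: H_def)
      ultimately show ?thesis
        using nn by (auto simp: H_def)
    qed
  qed (auto simp: H_def)
  then obtain u h where u: "\<And>n. u n \<in> H n" and h: "integrable M h"
    and lim: "AE x in M. (\<lambda>n. u n x) \<longlonglongrightarrow> h x" by blast
  have "(\<lambda>n. ennreal ((1/2) ^ n)) \<longlonglongrightarrow> ennreal 0"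
    by (intro tendsto_ennrealI LIMSEQ_power_zero) simp
  then have pow: "(\<lambda>n. ennreal ((1/2) ^ n)) \<longlonglongrightarrow> 0"
    by (simp only: ennreal_0)
  have "(\<lambda>n. excess (real n) (u n)) \<longlonglongrightarrow> 0"
  proof (rule tendsto_sandwich[OF _ _ tendsto_const pow])
    show "\<forall>\<^sub>F n in sequentially. excess (real n) (u n) \<le> ennreal ((1/2) ^ n)"
      using u by (simp add: H_def)
  qed simp
  moreover have "u n \<in> borel_measurable M" for n
    using u[of n] by (simp add: H_def)
  ultimately have "AE c in P. AE x in M. l x c \<le> h x + h (act (- c) x)"
    using lim by (intro AE_le_of_excess_tendsto_0)
  with h show ?thesis by blast
qed

end

section \<open>Reduction to symmetric lengths\<close>

context quasi_invariant_action
begin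

text \<open>Adding the length of g^-1 at g^-1 x to l gives a symmetric function that dominates l; by
  invariance of \<open>M\<close> its mean displacement is at most \<open>2 * C\<close>.\<close>

lemma length_bound:
  fixes l :: "'x \<Rightarrow> 'g \<Rightarrow> real" and C :: real
  assumes [measurable]: "(\<lambda>(x, g). l x g) \<in> borel_measurable (M \<Otimes>\<^sub>M P)"
    and nonneg: "\<And>x g. x \<in> space M \<Longrightarrow> 0 \<le> l x g"
    and sub: "AE g in P. AE h in P. AE x in M. l x (g + h) \<le> l x g + l (act (- g) x) h"
    and int: "AE g in P. (\<integral>\<^sup>+x. ennreal (l x g) \<partial>M) \<le> ennreal C"
    and C: "0 \<le> C"
  shows "\<exists>h. integrable M h \<and> (AE g in P. AE x in M. l x g \<le> h x + h (act (- g) x))"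
proof -
  define l' where "l' x g = l x g + l (act (- g) x) (- g)" for x g
  have "symmetric_length M P act l' (2 * C)"
  proof unfold_locales
    show "(\<lambda>(x, g). l' x g) \<in> borel_measurable (M \<Otimes>\<^sub>M P)"
      unfolding l'_def by measurable
    show "0 \<le> l' x g" if "x \<in> space M" for x g
      using that nonneg act_space by (simp add: l'_def)
    show "l' (act (- g) x) (- g) = l' x g" if "x \<in> space M" for x g
      using act_uminus_act[OF that, of "- g"] by (simp add: l'_def)
    show "0 \<le> 2 * C" using C by simp
    \<comment> \<open>Subadditivity of the added summand is the given inequality for the pair h^-1,
      g^-1 at the base point (gh)^-1 x. The order of the quantifiers over g and h must be exchanged
      before inverting both.\<close>
    have "AE h in P. AE x in M. AE g in P. l x (g + h) \<le> l x g + l (act (- g) x) h"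
      by (rule AE_rotate[OF sigma_finites(2,2,1) _ sub]) measurable
    then have "AE h in P. AE g in P. AE x in M. l x (g + h) \<le> l x g + l (act (- g) x) h"
    proof eventually_elim
      case (elim h)
      then show ?case by (intro AE_swap[OF sigma_finites]) measurable
    qed
    from AE_uminus[OF this] have "AE g in P. AE h in P. AE x in M.
        l x (- h + - g) \<le> l x (- h) + l (act (- (- h)) x) (- g)"
      by eventually_elim (rule AE_uminus)
    with sub show "AE g in P. AE h in P. AE x in M. l' x (g + h) \<le> l' x g + l' (act (- g) x) h"
    proof eventually_elim
      case (elim g)
      from elim show ?case
      proof eventually_elim
        case (elim h)
        from elim(1) AE_act[OF elim(2), of "- (g + h)"] AE_space show ?case
        proof eventually_elim
          case (elim x)
          have group: "h + (- h - g) = - g"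
            by (simp add: diff_conv_add_uminus add.assoc[symmetric] del: add_uminus_conv_diff)
          have "act h (act (- (g + h)) x) = act (- g) x"
            using elim(3) by (simp add: minus_add group flip: act_add)
          moreover have "act (- h) (act (- g) x) = act (- (g + h)) x"
            using elim(3) by (simp add: minus_add flip: act_add)
          ultimately show ?case
            using elim(1,2) by (simp add: l'_def minus_add)
        qed
      qed
    qed
    show "AE g in P. (\<integral>\<^sup>+x. ennreal (l' x g) \<partial>M) \<le> ennreal (2 * C)"
      using int AE_uminus[OF int]
    proof eventually_elim
      case (elim g)
      have [measurable]: "(\<lambda>x. l x g) \<in> borel_measurable M" "(\<lambda>x. l x (- g)) \<in> borel_measurable M"
        by measurable
      have "(\<integral>\<^sup>+x. ennreal (l' x g) \<partial>M)
          = (\<integral>\<^sup>+x. ennreal (l x g) + ennreal (l (act (- g) x) (- g)) \<partial>M)"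
        using nonneg act_space by (intro nn_integral_cong) (simp add: l'_def)
      also have "\<dots> = (\<integral>\<^sup>+x. ennreal (l x g) \<partial>M) + (\<integral>\<^sup>+x. ennreal (l (act (- g) x) (- g)) \<partial>M)"
        by (intro nn_integral_add) measurable
      also have "\<dots> = (\<integral>\<^sup>+x. ennreal (l x g) \<partial>M) + (\<integral>\<^sup>+x. ennreal (l x (- g)) \<partial>M)"
        by (subst nn_integral_act[of "\<lambda>x. ennreal (l x (- g))" "- g"]) simp_all
      also have "\<dots> \<le> ennreal C + ennreal C"
        using elim by (rule add_mono)
      also have "\<dots> = ennreal (2 * C)"
        using C by (simp flip: ennreal_plus)
      finally show ?case .
    qed
  qed
  from symmetric_length.symmetric_length_bound[OF this] obtain h
    where h: "integrable M h" and bound: "AE g in P. AE x in M. l' x g \<le> h x + h (act (- g) x)"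
    by blast
  from bound have "AE g in P. AE x in M. l x g \<le> h x + h (act (- g) x)"
  proof eventually_elim
    case (elim g)
    from elim AE_space show ?case
    proof eventually_elim
      case (elim x)
      then show ?case
        using nonneg[OF act_space, of x "- g" "- g"] by (simp add: l'_def)
    qed
  qed
  with h show ?thesis by blast
qed

end

section \<open>Haar measure and an equivalent probability measure\<close>

text \<open>Local compactness covers the group by open sets contained in compact ones, and Lindelof
  leaves countably many. Compact sets are closed in a Hausdorff space, hence measurable, and have
  finite Haar measure.\<close>

lemma sigma_finite_haar_measure:
  fixes \<mu> :: "'g::{topological_group_add, second_countable_topology, t2_space} measure"
  assumes lc: "locally_compact_space (euclidean :: 'g topology)" and haar: "haar_measure \<mu>"
  shows "sigma_finite_measure \<mu>"
proof
  have sets: "sets \<mu> = sets borel" using haar by (simp add: haar_measure_def)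
  define \<U> where "\<U> = {U :: 'g set. open U \<and> (\<exists>K. compact K \<and> U \<subseteq> K)}"
  have cover: "\<Union>\<U> = UNIV"
    using lc by (fastforce simp: locally_compact_space_def \<U>_def)
  obtain \<V> where \<V>: "\<V> \<subseteq> \<U>" "countable \<V>" "\<Union>\<V> = \<Union>\<U>"
    using Lindelof[of \<U>] by (auto simp: \<U>_def)
  have fin: "emeasure \<mu> U \<noteq> \<infinity>" if U: "U \<in> \<U>" for U
  proof -
    from U obtain K where K: "compact K" "U \<subseteq> K" by (auto simp: \<U>_def)
    have "emeasure \<mu> U \<le> emeasure \<mu> K"
      using K by (intro emeasure_mono) (simp_all add: sets compact_imp_closed)
    also have "\<dots> < \<infinity>" using haar K by (simp add: haar_measure_def)
    finally show ?thesis by simp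
  qed
  show "\<exists>A. countable A \<and> A \<subseteq> sets \<mu> \<and> \<Union>A = space \<mu> \<and> (\<forall>a\<in>A. emeasure \<mu> a \<noteq> \<infinity>)"
  proof (intro exI conjI ballI)
    show "countable \<V>" by fact
    show "\<V> \<subseteq> sets \<mu>" using \<V>(1) by (auto simp: sets \<U>_def)
    show "\<Union>\<V> = space \<mu>" using \<V>(3) cover sets_eq_imp_space_eq[OF sets] by simp
    show "emeasure \<mu> a \<noteq> \<infinity>" if "a \<in> \<V>" for a using that \<V>(1) fin by blast
  qed
qed

lemma haar_AE_translate:
  fixes \<mu> :: "'g::{topological_group_add, second_countable_topology} measure"
  assumes haar: "haar_measure \<mu>" and Q: "AE g in \<mu>. Q g"
  shows "AE g in \<mu>. Q (k + g)"
proof (rule AE_distrD[where M'=\<mu> and f="\<lambda>g. k + g"])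
  have [measurable_cong]: "sets \<mu> = sets borel" using haar by (simp add: haar_measure_def)
  show "(\<lambda>g. k + g) \<in> \<mu> \<rightarrow>\<^sub>M \<mu>" by measurable
  have "distr \<mu> \<mu> (\<lambda>g. k + g) = \<mu>" using haar by (simp add: haar_measure_def)
  with Q show "AE g in distr \<mu> \<mu> (\<lambda>g. k + g). Q g" by (simp only:)
qed

lemma haar_ae_filter_neq_bot:
  assumes "haar_measure \<mu>"
  shows "ae_filter \<mu> \<noteq> bot"
  using assms sets_eq_imp_space_eq[of \<mu> borel] by (simp add: haar_measure_def ae_filter_eq_bot_iff)

text \<open>
  If \<open>N\<close> is null, then by left invariance and Fubini \<open>{x. - x + y \<in> N}\<close> is null for some \<open>y\<close>, and
  this set is a left translate of \<open>- N\<close>.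
\<close>

lemma haar_AE_uminus:
  fixes \<mu> :: "'g::{topological_group_add, second_countable_topology} measure"
  assumes haar: "haar_measure \<mu>" and "sigma_finite_measure \<mu>" and Q: "AE g in \<mu>. Q g"
  shows "AE g in \<mu>. Q (- g)"
proof -
  have [measurable_cong]: "sets \<mu> = sets borel" using haar by (simp add: haar_measure_def)
  have [simp]: "space \<mu> = UNIV" using sets_eq_imp_space_eq[OF \<open>sets \<mu> = sets borel\<close>] by simp
  obtain N where N: "N \<in> null_sets \<mu>" "{g. \<not> Q g} \<subseteq> N"
    using Q by (auto simp: eventually_ae_filter)
  then have [measurable]: "N \<in> sets borel" using \<open>sets \<mu> = sets borel\<close> by auto
  have "AE x in \<mu>. AE y in \<mu>. - x + y \<notin> N"
    using haar_AE_translate[OF haar AE_not_in[OF N(1)]] by simp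
  then have "AE y in \<mu>. AE x in \<mu>. - x + y \<notin> N"
    by (rule AE_swap[OF assms(2,2), rotated]) measurable
  from eventually_happens'[OF haar_ae_filter_neq_bot[OF haar] this]
  obtain y where "AE x in \<mu>. - x + y \<notin> N" ..
  from haar_AE_translate[OF haar this, where k=y] have "AE x in \<mu>. - (y + x) + y \<notin> N" .
  then have "AE x in \<mu>. - x \<notin> N"
    by (simp add: minus_add diff_conv_add_uminus add.assoc del: add_uminus_conv_diff)
  then show ?thesis
  proof eventually_elim
    case (elim g)
    then show ?case using N(2) by blast
  qed
qed

text \<open>Normalise a strictly positive integrable density; positivity everywhere makes the null
  sets agree.\<close>

lemma (in sigma_finite_measure) obtain_equivalent_prob_space:
  assumes "ae_filter M \<noteq> bot"
  obtains P where "prob_space P" "sets P = sets M" "\<And>Q. (AE x in P. Q x) \<longleftrightarrow> (AE x in M. Q x)"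
proof -
  obtain f :: "'a \<Rightarrow> real" where f[measurable]: "f \<in> borel_measurable M"
    and pos: "\<And>x. 0 < f x" and int: "integrable M f"
    using obtain_positive_integrable_function by metis
  define c where "c = (\<integral>x. f x \<partial>M)"
  have "c \<noteq> 0"
  proof
    assume "c = 0"
    then have "AE x in M. f x = 0"
      using integral_nonneg_eq_0_iff_AE[OF int] pos by (simp add: c_def less_imp_le)
    then have "AE x in M. False"
      by eventually_elim (use pos in \<open>simp add: less_imp_neq[symmetric]\<close>)
    with assms show False by (simp add: eventually_False)
  qed
  moreover have "0 \<le> c"
    unfolding c_def using pos by (intro Bochner_Integration.integral_nonneg) (simp add: less_imp_le)
  ultimately have c: "0 < c" by simp
  define P where "P = density M (\<lambda>x. ennreal (f x / c))"
  have "emeasure P (space P) = (\<integral>\<^sup>+x. ennreal (f x / c) \<partial>M)"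
    by (simp add: P_def emeasure_density nn_integral_set_ennreal cong: nn_integral_cong)
  also have "\<dots> = ennreal (\<integral>x. f x / c \<partial>M)"
    using int pos c by (intro nn_integral_eq_integral) (simp_all add: less_imp_le)
  also have "\<dots> = 1"
    using c by (simp add: c_def[symmetric])
  finally have "prob_space P" by (rule prob_spaceI)
  moreover have "sets P = sets M" by (simp add: P_def)
  moreover have "(AE x in P. Q x) \<longleftrightarrow> (AE x in M. Q x)" for Q
    unfolding P_def using pos c by (subst AE_density) simp_all
  ultimately show thesis using that by blast
qed

theorem theorem3:
  fixes \<mu> :: "'g::{topological_group_add, second_countable_topology, t2_space} measure"
    and M :: "'x measure"
    and act :: "'g \<Rightarrow> 'x \<Rightarrow> 'x"
    and l :: "'x \<Rightarrow> 'g \<Rightarrow> real"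
  assumes "locally_compact_space (euclidean :: 'g topology)"
    and "haar_measure \<mu>"
    and "standard_prob_space M"
    and "measure_preserving_action M act"
    and "(\<lambda>(x, g). l x g) \<in> borel_measurable (M \<Otimes>\<^sub>M \<mu>)"
    and "\<And>x g. x \<in> space M \<Longrightarrow> 0 \<le> l x g"
    and "AE (x, g, h) in M \<Otimes>\<^sub>M (\<mu> \<Otimes>\<^sub>M \<mu>). l x (g + h) \<le> l x g + l (act (- g) x) h"
    and "esssup \<mu> (\<lambda>g. \<integral>\<^sup>+x. ennreal (l x g) \<partial>M) < \<infinity>"
  shows "\<exists>h :: 'x \<Rightarrow> real. integrable M h \<and>
           (AE (x, g) in M \<Otimes>\<^sub>M \<mu>. l x g \<le> h x + h (act (- g) x))"
proof -
  have sets_\<mu>[measurable_cong]: "sets \<mu> = sets borel" using assms(2) by (simp add: haar_measure_def)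
  interpret \<mu>: sigma_finite_measure \<mu> by (rule sigma_finite_haar_measure[OF assms(1,2)])
  interpret M: prob_space M using assms(3) by (simp add: standard_prob_space_def)
  obtain P where "prob_space P" and sets_P: "sets P = sets \<mu>"
    and AE_P: "\<And>Q. (AE x in P. Q x) \<longleftrightarrow> (AE x in \<mu>. Q x)"
    by (rule \<mu>.obtain_equivalent_prob_space[OF haar_ae_filter_neq_bot[OF assms(2)]]) blast
  interpret P: prob_space P by fact
  interpret quasi_invariant_action M P act
  proof
    show "sets P = sets borel" using sets_P sets_\<mu> by simp
    show "AE g in P. Q (k + g)" if "AE g in P. Q g" for Q k
      using that haar_AE_translate[OF assms(2)] by (simp add: AE_P)
    show "AE g in P. Q (- g)" if "AE g in P. Q g" for Q
      using that haar_AE_uminus[OF assms(2) \<mu>.sigma_finite_measure_axioms] by (simp add: AE_P)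
  qed (use assms(4) in \<open>auto simp: measure_preserving_action_def\<close>)
  have l_mu[measurable]: "(\<lambda>(x, g). l x g) \<in> borel_measurable (M \<Otimes>\<^sub>M \<mu>)" by fact
  have l_P[measurable]: "(\<lambda>(x, g). l x g) \<in> borel_measurable (M \<Otimes>\<^sub>M P)"
    using assms(5) by (simp add: measurable_cong_sets[OF sets_pair_measure_cong[OF refl sets_P] refl])
  interpret \<mu>\<mu>: pair_sigma_finite \<mu> \<mu> ..
  interpret M\<mu>\<mu>: pair_sigma_finite M "\<mu> \<Otimes>\<^sub>M \<mu>" ..
  \<comment> \<open>The hypothesis on the triple product becomes iterated quantifiers, which pass to
    \<open>P\<close> one at a time since they involve null sets only; x is then rotated to the
    innermost place.\<close>
  have "AE x in M. AE w in \<mu> \<Otimes>\<^sub>M \<mu>. case w of (g, h) \<Rightarrow> l x (g + h) \<le> l x g + l (act (- g) x) h"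
    using M\<mu>\<mu>.AE_pair[OF assms(7)] by simp
  then have "AE x in M. AE g in P. AE h in P. l x (g + h) \<le> l x g + l (act (- g) x) h"
    unfolding AE_P by eventually_elim (use \<mu>\<mu>.AE_pair in fastforce)
  then have sub: "AE g in P. AE h in P. AE x in M. l x (g + h) \<le> l x g + l (act (- g) x) h"
    by (intro AE_rotate[OF sigma_finites(1,2,2)]) measurable
  obtain C where C: "0 \<le> C" "esssup \<mu> (\<lambda>g. \<integral>\<^sup>+x. ennreal (l x g) \<partial>M) = ennreal C"
    using assms(8) by (cases "esssup \<mu> (\<lambda>g. \<integral>\<^sup>+x. ennreal (l x g) \<partial>M)") auto
  have int: "AE g in P. (\<integral>\<^sup>+x. ennreal (l x g) \<partial>M) \<le> ennreal C"
    unfolding AE_P C(2)[symmetric] by (rule esssup_AE)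
  from length_bound[OF l_P assms(6) sub int C(1)] obtain h
    where h: "integrable M h" and bound: "AE g in P. AE x in M. l x g \<le> h x + h (act (- g) x)"
    by blast
  have [measurable]: "h \<in> borel_measurable M" using h by simp
  \<comment> \<open>Measurability of the final inequality allows the return from iterated
    quantifiers to the product with Haar measure.\<close>
  have "AE x in M. AE g in \<mu>. l x g \<le> h x + h (act (- g) x)"
    using bound unfolding AE_P
    by (intro AE_swap[OF \<mu>.sigma_finite_measure_axioms M.sigma_finite_measure_axioms]) measurable
  then have "AE (x, g) in M \<Otimes>\<^sub>M \<mu>. l x g \<le> h x + h (act (- g) x)"
    by (intro AE_pair_measureI[OF M.sigma_finite_measure_axioms \<mu>.sigma_finite_measure_axioms]) measurable
  with h show ?thesis by blast
qed

end
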